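(* Let $G$ be a topological group and let $X$ be a subspace of $G$ that is homeomorphic to an uncountable subspace of the Sorgenfrey line. Then $s(G)\ge s(X\times X)$.
   Context: The Sorgenfrey line is the set of real numbers $\mathbb{R}$ endowed with the topology generated by the half-intervals $[a,b)$, where $a<b$ are arbitrary real numbers. For a topological space $Y$, the spread of $Y$ is the cardinal $s(Y)=\sup\{|D| : D\subset Y \text{ is a discrete subspace of } Y\}$, where a subspace is discrete if its subspace topology is discrete. The product $X\times X$ carries the product topology. *)

theory Defs
  imports "HOL-Analysis.Analysis"
begin

unbundle cardinal_syntax

definition sorgenfrey :: "real topology" where
  "sorgenfrey = topology_generated_by {{a..<b} | a b. a < b}"

definition discrete_subspace :: "'a topology \<Rightarrow> 'a set \<Rightarrow> bool" where
  "discrete_subspace Y D \<longleftrightarrow> D \<subseteq> topspace Y \<and> subtopology Y D = discrete_topology D"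

text \<open>
  A cardinal is a cardinal order, compared by \<open>\<le>o\<close>, so a supremum of cardinals is only
  determined up to \<open>=o\<close>. All cardinalities of discrete subspaces are bounded by the
  cardinality of the space, so the supremum is realised by a cardinal order on
  the point type; \<open>spread_least\<close> below shows that it is least among upper bounds
  on arbitrary types.
\<close>

definition spread_bound :: "'a topology \<Rightarrow> 'b rel \<Rightarrow> bool" where
  "spread_bound Y k \<longleftrightarrow> Card_order k \<and> (\<forall>D. discrete_subspace Y D \<longrightarrow> |D| \<le>o k)"

definition spread :: "'a topology \<Rightarrow> 'a rel" where
  "spread Y = (SOME k. spread_bound Y k \<and> (\<forall>k' :: 'a rel. spread_bound Y k' \<longrightarrow> k \<le>o k'))"

lemma topspace_sorgenfrey [simp]: "topspace sorgenfrey = UNIV"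
proof -
  have "x \<in> \<Union> {{a..<b} | a b. a < b}" for x :: real
  proof (rule UnionI)
    show "{x..<x+1} \<in> {{a..<b} | a b. a < b}"
      using less_add_one[of x] by blast
  qed simp
  then show ?thesis
    unfolding sorgenfrey_def topology_generated_by_topspace by blast
qed

lemma spread_bound_card_of_topspace: "spread_bound Y |topspace Y|"
  unfolding spread_bound_def discrete_subspace_def
  by (simp add: card_of_Card_order card_of_mono1)

lemma spread_props:
  fixes Y :: "'a topology"
  shows "spread_bound Y (spread Y) \<and> (\<forall>k' :: 'a rel. spread_bound Y k' \<longrightarrow> spread Y \<le>o k')"
  unfolding spread_def
proof (rule someI_ex)
  have "{k :: 'a rel. spread_bound Y k} \<noteq> {}"
    using spread_bound_card_of_topspace by blast
  moreover have "\<forall>k \<in> {k :: 'a rel. spread_bound Y k}. Card_order k"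
    by (simp add: spread_bound_def)
  ultimately show "\<exists>k :: 'a rel. spread_bound Y k \<and> (\<forall>k' :: 'a rel. spread_bound Y k' \<longrightarrow> k \<le>o k')"
    using exists_minim_Card_order[of "{k :: 'a rel. spread_bound Y k}"] by blast
qed

lemma Card_order_spread: "Card_order (spread Y)"
  using spread_props[of Y] by (simp add: spread_bound_def)

lemma card_of_discrete_le_spread: "discrete_subspace Y D \<Longrightarrow> |D| \<le>o spread Y"
  using spread_props[of Y] by (simp add: spread_bound_def)

lemma spread_le_card_of_topspace: "spread Y \<le>o |topspace Y|"
  using spread_props[of Y] spread_bound_card_of_topspace by blast

lemma spread_least:
  fixes Y :: "'a topology" and k :: "'b rel"
  assumes "Card_order k" "\<And>D. discrete_subspace Y D \<Longrightarrow> |D| \<le>o k"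
  shows "spread Y \<le>o k"
proof (cases "k \<le>o |UNIV :: 'a set|")
  case True
  have "|Field k| \<le>o |UNIV :: 'a set|"
    using True card_of_Field_ordIso[OF assms(1)] ordIso_ordLeq_trans by blast
  then obtain f :: "'b \<Rightarrow> 'a" where f: "inj_on f (Field k)"
    using card_of_ordLeq[of "Field k" "UNIV :: 'a set"] by blast
  have "|Field k| =o |f ` Field k|"
    using f card_of_ordIsoI[of f "Field k" "f ` Field k"] by (simp add: bij_betw_def)
  then have iso: "k =o |f ` Field k|"
    using card_of_Field_ordIso[OF assms(1)] ordIso_symmetric ordIso_transitive by blast
  have "spread_bound Y |f ` Field k|"
    unfolding spread_bound_def using assms(2) iso card_of_Card_order ordLeq_ordIso_trans by blast
  then have "spread Y \<le>o |f ` Field k|"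
    using spread_props[of Y] by blast
  then show ?thesis
    using iso ordIso_symmetric ordLeq_ordIso_trans by blast
next
  case False
  then have "|UNIV :: 'a set| \<le>o k"
    using ordLeq_total[of k "|UNIV :: 'a set|"] assms(1) card_of_Well_order
      card_order_on_well_order_on by blast
  moreover have "spread Y \<le>o |UNIV :: 'a set|"
    using spread_le_card_of_topspace card_of_mono1[of "topspace Y" UNIV] ordLeq_transitive by blast
  ultimately show ?thesis
    using ordLeq_transitive by blast
qed

end

theory Submission
  imports Defs
begin

text \<open>
  Let \<open>k\<close> be the embedding of \<open>X\<close> into the Sorgenfrey line. The theorem holds because
  addition \<open>(u, v) \<mapsto> u + v\<close> carries a discrete subset \<open>D\<close> of \<open>X \<times> X\<close>, once it is cut into
  countably many pieces, injectively onto discrete subsets of the group.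

  To see this, let \<open>p = (u, v)\<close> be a point of \<open>D\<close>. As \<open>D\<close> is discrete, for some \<open>e > 0\<close> no other
  point of \<open>D\<close> has coordinates \<open>(k x, k y)\<close> in the square \<open>[k u, k u + e) \<times> [k v, k v + e)\<close>.
  Cut \<open>D\<close> into countably many cells so that within one cell the same \<open>e\<close> works
  for all points and coordinates differ by less than \<open>e\<close>. Then two distinct points of a cell are
  never comparable in the product order: one coordinate increases strictly and the other one
  decreases strictly. If \<open>q = (x, y)\<close> lies in the cell of \<open>p\<close> and, say, \<open>k x \<ge> k u\<close>, then \<open>x\<close> is
  topologically near \<open>u\<close>. If moreover \<open>x + y\<close> is near \<open>u + v\<close>, then \<open>y = - x + (x + y)\<close> is near
  \<open>v\<close>, so that \<open>k y \<ge> k v\<close>, and \<open>q = p\<close>. The case \<open>k y \<ge> k v\<close> is symmetric. Hence each point of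
  the cell has a sum with a neighbourhood that contains no sum of another point
  (\<open>sum_near_imp_coordinate_ge\<close>, \<open>card_discrete_square_le_spread\<close>).

  So each of the countably many cells has at most \<open>s(G)\<close> points. The spread \<open>s(G)\<close> is
  infinite because all finite subsets of the infinite set \<open>X\<close> are discrete, and therefore \<open>D\<close>
  itself has at most \<open>s(G)\<close> points.
\<close>

section \<open>Discrete subspaces and spread\<close>

lemma discrete_subspace_iff_isolated:
  "discrete_subspace Y D \<longleftrightarrow> D \<subseteq> topspace Y \<and> (\<forall>x\<in>D. \<exists>U. openin Y U \<and> U \<inter> D = {x})"
proof (cases "D \<subseteq> topspace Y")
  case True
  then have "subtopology Y D = discrete_topology D \<longleftrightarrow> (\<forall>x\<in>D. openin (subtopology Y D) {x})"
    using discrete_topology_unique[of D "subtopology Y D"]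
    by (simp add: eq_commute Int_absorb1)
  then show ?thesis
    using True by (auto simp: discrete_subspace_def openin_subtopology eq_commute)
qed (simp add: discrete_subspace_def)

lemma card_le_spread_if_isolated_values:
  assumes "\<And>p. p \<in> E \<Longrightarrow> \<exists>N. openin Y N \<and> f p \<in> N \<and> (\<forall>q\<in>E. f q \<in> N \<longrightarrow> q = p)"
  shows "|E| \<le>o spread Y"
proof -
  have "inj_on f E"
    by (rule inj_onI) (metis assms)
  moreover have "discrete_subspace Y (f ` E)"
    unfolding discrete_subspace_iff_isolated
  proof (intro conjI ballI)
    show "f ` E \<subseteq> topspace Y"
      using assms openin_subset by fastforce
    fix z assume "z \<in> f ` E"
    then obtain p where p: "p \<in> E" "z = f p" by blast
    obtain N where N: "openin Y N" "f p \<in> N" "\<forall>q\<in>E. f q \<in> N \<longrightarrow> q = p"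
      using assms[OF p(1)] by blast
    then have "N \<inter> f ` E = {z}" using p by blast
    then show "\<exists>U. openin Y U \<and> U \<inter> f ` E = {z}" using N(1) by blast
  qed
  then have "|f ` E| \<le>o spread Y" by (rule card_of_discrete_le_spread)
  ultimately show ?thesis
    using card_of_ordIsoI[of f E "f ` E"] ordIso_ordLeq_trans
    by (metis bij_betw_def)
qed

lemma infinite_Field_spread:
  assumes "infinite X" and "\<And>F. finite F \<Longrightarrow> F \<subseteq> X \<Longrightarrow> discrete_subspace Y F"
  shows "infinite (Field (spread Y))"
proof
  assume fin: "finite (Field (spread Y))"
  obtain F where F: "finite F" "card F = Suc (card (Field (spread Y)))" "F \<subseteq> X"
    using infinite_arbitrarily_large[OF assms(1)] by blast
  have "|F| \<le>o spread Y"
    using assms(2) F card_of_discrete_le_spread by blast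
  then have "|F| \<le>o |Field (spread Y)|"
    using card_of_Field_ordIso[OF Card_order_spread, of Y] ordIso_symmetric ordLeq_ordIso_trans
    by blast
  then obtain f where "inj_on f F" "f ` F \<subseteq> Field (spread Y)"
    using card_of_ordLeq[of F] by metis
  then have "card F \<le> card (Field (spread Y))"
    using fin by (rule card_inj_on_le)
  then show False using F by simp
qed

section \<open>Sorgenfrey coordinates\<close>

lemma openin_sorgenfrey_Ico:
  assumes "a < b"
  shows "openin sorgenfrey {a..<b}"
  unfolding sorgenfrey_def using assms by (intro topology_generated_by_Basis) blast

lemma openin_sorgenfrey_right_nbhd:
  assumes "openin sorgenfrey U" "x \<in> U"
  shows "\<exists>e>0. {x..<x+e} \<subseteq> U"
proof -
  have "generate_topology_on {{a..<b} | a b :: real. a < b} U"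
    using assms(1) unfolding sorgenfrey_def by (rule openin_topology_generated_by)
  then show ?thesis
    using assms(2)
  proof induct
    case (Int A B)
    then obtain d e where de: "d > 0" "e > 0" "{x..<x+d} \<subseteq> A" "{x..<x+e} \<subseteq> B" by blast
    then have "{x..<x + min d e} \<subseteq> A \<inter> B" by (auto simp: subset_iff)
    then show ?case using de by (intro exI[of _ "min d e"]) simp
  next
    case (UN K)
    then show ?case by (metis UnionE Union_upper subset_trans)
  next
    case (Basis s)
    then obtain a b where "s = {a..<b}" by blast
    with Basis show ?case by (intro exI[of _ "b - x"]) auto
  qed simp
qed

text \<open>
  An embedding of a subspace into the Sorgenfrey line, expressed by neighbourhoods in the ambient
  space: the first property of \<open>u\<close> is continuity of the inverse of \<open>k\<close>, the second one continuity
  of \<open>k\<close>.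
\<close>

definition sorgenfrey_embedding :: "'a::topological_space set \<Rightarrow> ('a \<Rightarrow> real) \<Rightarrow> bool" where
  "sorgenfrey_embedding X k \<longleftrightarrow> inj_on k X \<and>
     (\<forall>u\<in>X. (\<forall>U. open U \<longrightarrow> u \<in> U \<longrightarrow> (\<exists>e>0. \<forall>x\<in>X. k x \<in> {k u..<k u+e} \<longrightarrow> x \<in> U)) \<and>
            (\<forall>e>0. \<exists>U. open U \<and> u \<in> U \<and> (\<forall>x\<in>X \<inter> U. k x \<in> {k u..<k u+e})))"

lemma homeomorphic_imp_sorgenfrey_embedding:
  assumes "subtopology euclidean X homeomorphic_space subtopology sorgenfrey S"
  obtains k where "sorgenfrey_embedding X k" "k ` X = S"
proof -
  obtain k h where hm: "homeomorphic_maps (subtopology euclidean X) (subtopology sorgenfrey S) k h"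
    using assms unfolding homeomorphic_space_def by blast
  have ck: "continuous_map (subtopology euclidean X) (subtopology sorgenfrey S) k"
    and ch: "continuous_map (subtopology sorgenfrey S) (subtopology euclidean X) h"
    and hk: "\<And>x. x \<in> X \<Longrightarrow> h (k x) = x" and kh: "\<And>s. s \<in> S \<Longrightarrow> k (h s) = s"
    using hm by (auto simp: homeomorphic_maps_def)
  have kX: "k x \<in> S" if "x \<in> X" for x
    using ck that by (auto simp: continuous_map_def)
  have hS: "h s \<in> X" if "s \<in> S" for s
    using ch that by (auto simp: continuous_map_def)
  have right_nbhd: "\<exists>e>0. \<forall>x\<in>X. k x \<in> {k u..<k u+e} \<longrightarrow> x \<in> U"
    if u: "u \<in> X" and U: "open U" "u \<in> U" for u U
  proof -
    have "openin (subtopology euclidean X) (X \<inter> U)"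
      using U by (auto simp: openin_subtopology)
    then have "openin (subtopology sorgenfrey S) {s \<in> S. h s \<in> X \<inter> U}"
      using openin_continuous_map_preimage[OF ch] by fastforce
    then obtain T where T: "openin sorgenfrey T" "{s \<in> S. h s \<in> X \<inter> U} = T \<inter> S"
      unfolding openin_subtopology by blast
    have T_iff: "k x \<in> T \<longleftrightarrow> x \<in> U" if "x \<in> X" for x
      using T(2) kX[OF that] hk[OF that] that by (metis (mono_tags, lifting) IntE IntI mem_Collect_eq)
    then obtain e where "e > 0" "{k u..<k u+e} \<subseteq> T"
      using openin_sorgenfrey_right_nbhd[OF T(1), of "k u"] u U(2) by metis
    then show ?thesis using T_iff by blast
  qed
  have small_nbhd: "\<exists>U. open U \<and> u \<in> U \<and> (\<forall>x\<in>X \<inter> U. k x \<in> {k u..<k u+e})"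
    if u: "u \<in> X" and e: "e > 0" for u e
  proof -
    have "openin (subtopology sorgenfrey S) ({k u..<k u+e} \<inter> S)"
      using openin_sorgenfrey_Ico[of "k u" "k u + e"] e by (auto simp: openin_subtopology)
    then have "openin (subtopology euclidean X) {x \<in> X. k x \<in> {k u..<k u+e} \<inter> S}"
      using openin_continuous_map_preimage[OF ck] by fastforce
    then obtain T where T: "open T" "{x \<in> X. k x \<in> {k u..<k u+e} \<inter> S} = T \<inter> X"
      unfolding openin_subtopology by auto
    have T_iff: "x \<in> T \<longleftrightarrow> k x \<in> {k u..<k u+e}" if "x \<in> X" for x
      using T(2) kX[OF that] that by (metis (mono_tags, lifting) IntE IntI mem_Collect_eq)
    then show ?thesis using u e T(1) by (intro exI[of _ T]) auto
  qed
  have "sorgenfrey_embedding X k"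
    unfolding sorgenfrey_embedding_def
    by (intro conjI ballI allI impI right_nbhd small_nbhd inj_on_inverseI[of X h k] hk)
  moreover have "k ` X = S"
    using kX hS kh by (metis image_eqI image_subset_iff subsetI subset_antisym)
  ultimately show ?thesis by (rule that)
qed

lemma finite_subset_discrete_if_sorgenfrey_embedding:
  assumes k: "sorgenfrey_embedding X k" and F: "finite F" "F \<subseteq> X"
  shows "discrete_subspace euclidean F"
  unfolding discrete_subspace_iff_isolated
proof (intro conjI ballI)
  fix u assume u: "u \<in> F"
  obtain d where d: "d > 0" "\<forall>t\<in>k ` F. t \<noteq> k u \<longrightarrow> d \<le> dist (k u) t"
    using finite_set_avoid[of "k ` F" "k u"] finite_imageI[OF F(1), of k] by metis
  obtain U where U: "open U" "u \<in> U" "\<forall>x\<in>X \<inter> U. k x \<in> {k u..<k u+d}"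
    using k u F(2) d(1) unfolding sorgenfrey_embedding_def by (meson subsetD)
  have "x = u" if "x \<in> U \<inter> F" for x
  proof -
    have "k x \<in> {k u..<k u+d}" using that U(3) F(2) by blast
    moreover have "k x \<noteq> k u \<Longrightarrow> d \<le> \<bar>k u - k x\<bar>"
      using that d(2) by (simp add: dist_real_def)
    ultimately have "k x = k u" by fastforce
    moreover have "inj_on k X" using k by (simp add: sorgenfrey_embedding_def)
    ultimately show ?thesis
      using that u F(2) by (meson IntD2 inj_onD subsetD)
  qed
  then have "U \<inter> F = {u}" using U(2) u by blast
  then show "\<exists>U. openin euclidean U \<and> U \<inter> F = {u}"
    using U(1) open_openin by blast
qed simp

section \<open>Sums of two points\<close>

lemma open_nbhds_left_summand:
  fixes u v :: "'g::topological_group_add"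
  assumes "open B" "v \<in> B"
  obtains A N where "open A" "u \<in> A" "open N" "u + v \<in> N" "\<And>x y. x \<in> A \<Longrightarrow> x + y \<in> N \<Longrightarrow> y \<in> B"
proof -
  have "((\<lambda>p. - fst p + snd p) \<longlongrightarrow> - u + (u + v)) (nhds u \<times>\<^sub>F nhds (u + v))"
    by (intro tendsto_add tendsto_minus filterlim_fst filterlim_snd)
  then have "((\<lambda>p. - fst p + snd p) \<longlongrightarrow> v) (nhds u \<times>\<^sub>F nhds (u + v))"
    by (simp add: add.assoc[symmetric])
  then have "\<forall>\<^sub>F p in nhds u \<times>\<^sub>F nhds (u + v). - fst p + snd p \<in> B"
    using assms by (auto simp: tendsto_def)
  then obtain P Q where "eventually P (nhds u)" "eventually Q (nhds (u + v))"
      and PQ: "\<And>x s. P x \<Longrightarrow> Q s \<Longrightarrow> - x + s \<in> B"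
    by (auto simp: eventually_prod_filter)
  then obtain A N where AN: "open A" "u \<in> A" "\<forall>x\<in>A. P x" "open N" "u + v \<in> N" "\<forall>s\<in>N. Q s"
    by (auto simp: eventually_nhds)
  have "y \<in> B" if "x \<in> A" "x + y \<in> N" for x y
    using PQ[of x "x + y"] AN that by (simp add: add.assoc[symmetric])
  with AN show ?thesis by (intro that)
qed

lemma open_nbhds_right_summand:
  fixes u v :: "'g::topological_group_add"
  assumes "open B" "u \<in> B"
  obtains A N where "open A" "v \<in> A" "open N" "u + v \<in> N" "\<And>x y. y \<in> A \<Longrightarrow> x + y \<in> N \<Longrightarrow> x \<in> B"
proof -
  have "((\<lambda>p. snd p - fst p) \<longlongrightarrow> (u + v) - v) (nhds v \<times>\<^sub>F nhds (u + v))"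
    by (intro tendsto_diff filterlim_fst filterlim_snd)
  then have "\<forall>\<^sub>F p in nhds v \<times>\<^sub>F nhds (u + v). snd p - fst p \<in> B"
    using assms by (auto simp: tendsto_def)
  then obtain P Q where "eventually P (nhds v)" "eventually Q (nhds (u + v))"
      and PQ: "\<And>y s. P y \<Longrightarrow> Q s \<Longrightarrow> s - y \<in> B"
    by (auto simp: eventually_prod_filter)
  then obtain A N where AN: "open A" "v \<in> A" "\<forall>x\<in>A. P x" "open N" "u + v \<in> N" "\<forall>s\<in>N. Q s"
    by (auto simp: eventually_nhds)
  have "x \<in> B" if "y \<in> A" "x + y \<in> N" for x y
    using PQ[of y "x + y"] AN that by simp
  with AN show ?thesis by (intro that)
qed

text \<open>
  The group structure enters here: a sum and one summand near their targets force the other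
  summand near its target, and nearness in \<open>X\<close> prevents its coordinate from dropping.
\<close>

lemma sum_near_imp_coordinate_ge:
  fixes X :: "'g::topological_group_add set"
  assumes k: "sorgenfrey_embedding X k" and u: "u \<in> X" and v: "v \<in> X"
  obtains e N where "e > 0" "open N" "u + v \<in> N"
    "\<And>x y. x \<in> X \<Longrightarrow> y \<in> X \<Longrightarrow> x + y \<in> N \<Longrightarrow> k x \<in> {k u..<k u+e} \<Longrightarrow> k v \<le> k y"
    "\<And>x y. x \<in> X \<Longrightarrow> y \<in> X \<Longrightarrow> x + y \<in> N \<Longrightarrow> k y \<in> {k v..<k v+e} \<Longrightarrow> k u \<le> k x"
proof -
  have upper: "\<exists>B. open B \<and> w \<in> B \<and> (\<forall>x\<in>X \<inter> B. k w \<le> k x)" if "w \<in> X" for w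
    using k that zero_less_one[where 'a = real] unfolding sorgenfrey_embedding_def
    by (meson atLeastLessThan_iff)
  have right: "\<exists>e>0. \<forall>x\<in>X. k x \<in> {k w..<k w+e} \<longrightarrow> x \<in> A" if "w \<in> X" "open A" "w \<in> A" for w A
    using k that unfolding sorgenfrey_embedding_def by blast
  obtain B where B: "open B" "v \<in> B" "\<forall>y\<in>X \<inter> B. k v \<le> k y" using upper[OF v] by blast
  obtain A N where A: "open A" "u \<in> A" and N: "open N" "u + v \<in> N"
    and AN: "\<And>x y. x \<in> A \<Longrightarrow> x + y \<in> N \<Longrightarrow> y \<in> B"
    using open_nbhds_left_summand[OF B(1,2)] by blast
  obtain d where d: "d > 0" "\<forall>x\<in>X. k x \<in> {k u..<k u+d} \<longrightarrow> x \<in> A"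
    using right[OF u A] by blast
  obtain B' where B': "open B'" "u \<in> B'" "\<forall>x\<in>X \<inter> B'. k u \<le> k x" using upper[OF u] by blast
  obtain A' N' where A': "open A'" "v \<in> A'" and N': "open N'" "u + v \<in> N'"
    and AN': "\<And>x y. y \<in> A' \<Longrightarrow> x + y \<in> N' \<Longrightarrow> x \<in> B'"
    using open_nbhds_right_summand[OF B'(1,2)] by blast
  obtain d' where d': "d' > 0" "\<forall>y\<in>X. k y \<in> {k v..<k v+d'} \<longrightarrow> y \<in> A'"
    using right[OF v A'] by blast
  show ?thesis
  proof (rule that[of "min d d'" "N \<inter> N'"])
    show "k v \<le> k y"
      if "x \<in> X" "y \<in> X" "x + y \<in> N \<inter> N'" "k x \<in> {k u..<k u + min d d'}" for x y
    proof -
      have "x \<in> A" using that d(2) by auto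
      then have "y \<in> B" using AN that by blast
      then show ?thesis using B(3) that by blast
    qed
    show "k u \<le> k x"
      if "x \<in> X" "y \<in> X" "x + y \<in> N \<inter> N'" "k y \<in> {k v..<k v + min d d'}" for x y
    proof -
      have "y \<in> A'" using that d'(2) by auto
      then have "x \<in> B'" using AN' that by blast
      then show ?thesis using B'(3) that by blast
    qed
  qed (use d d' N N' in auto)
qed

section \<open>Discrete subsets of the square\<close>

lemma discrete_square_isolating_box:
  assumes k: "sorgenfrey_embedding X k"
    and D: "discrete_subspace (prod_topology (subtopology euclidean X) (subtopology euclidean X)) D"
    and p: "(u, v) \<in> D"
  obtains e where "e > 0"
    "\<And>x y. (x, y) \<in> D \<Longrightarrow> k x \<in> {k u..<k u+e} \<Longrightarrow> k y \<in> {k v..<k v+e} \<Longrightarrow> (x, y) = (u, v)"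
proof -
  have DX: "D \<subseteq> X \<times> X" using D by (simp add: discrete_subspace_iff_isolated)
  obtain W where W: "openin (prod_topology (subtopology euclidean X) (subtopology euclidean X)) W"
      "W \<inter> D = {(u, v)}"
    using D p unfolding discrete_subspace_iff_isolated by blast
  then obtain P Q where PQ: "openin (subtopology euclidean X) P" "openin (subtopology euclidean X) Q"
      "u \<in> P" "v \<in> Q" "P \<times> Q \<subseteq> W"
    by (metis openin_prod_topology_alt Int_iff insertI1)
  obtain P' Q' where P': "open P'" "P = P' \<inter> X" and Q': "open Q'" "Q = Q' \<inter> X"
    using PQ(1,2) by (auto simp: openin_subtopology)
  have uv: "u \<in> X" "v \<in> X" using DX p by auto
  obtain d where d: "d > 0" "\<forall>x\<in>X. k x \<in> {k u..<k u+d} \<longrightarrow> x \<in> P'"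
    using k uv PQ(3) P' unfolding sorgenfrey_embedding_def by blast
  obtain d' where d': "d' > 0" "\<forall>y\<in>X. k y \<in> {k v..<k v+d'} \<longrightarrow> y \<in> Q'"
    using k uv PQ(4) Q' unfolding sorgenfrey_embedding_def by blast
  show ?thesis
  proof (rule that[of "min d d'"])
    fix x y assume xy: "(x, y) \<in> D" "k x \<in> {k u..<k u + min d d'}" "k y \<in> {k v..<k v + min d d'}"
    then have "(x, y) \<in> P \<times> Q" using DX d(2) d'(2) P' Q' by auto
    then show "(x, y) = (u, v)" using PQ(5) W(2) xy(1) by blast
  qed (use d d' in simp)
qed

lemma abs_diff_less_if_floor_mult_eq:
  fixes a b c :: real
  assumes "\<lfloor>a * c\<rfloor> = \<lfloor>b * c\<rfloor>" "c > 0"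
  shows "\<bar>a - b\<bar> < 1 / c"
proof -
  have "\<bar>a * c - b * c\<bar> < 1" using assms(1) by linarith
  then have "\<bar>a - b\<bar> * c < 1"
    using assms(2) by (simp add: left_diff_distrib[symmetric] abs_mult)
  then show ?thesis using assms(2) by (simp add: pos_less_divide_eq)
qed

lemma card_discrete_square_le_spread:
  fixes X :: "'g::topological_group_add set"
  assumes k: "sorgenfrey_embedding X k" and X: "infinite X"
    and D: "discrete_subspace (prod_topology (subtopology euclidean X) (subtopology euclidean X)) D"
  shows "|D| \<le>o spread (euclidean :: 'g topology)"
proof -
  let ?sum = "\<lambda>p :: 'g \<times> 'g. fst p + snd p"
  let ?box = "\<lambda>p e. {q. k (fst q) \<in> {k (fst p)..<k (fst p) + e} \<and> k (snd q) \<in> {k (snd p)..<k (snd p) + e}}"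
  have DX: "D \<subseteq> X \<times> X" using D by (simp add: discrete_subspace_iff_isolated)
  define good where "good p n N \<longleftrightarrow> open N \<and> ?sum p \<in> N \<and>
      D \<inter> ?box p (1 / real (Suc n)) \<subseteq> {p} \<and>
      (\<forall>q\<in>D. ?sum q \<in> N \<longrightarrow>
        (k (fst q) \<in> {k (fst p)..<k (fst p) + 1 / real (Suc n)} \<longrightarrow> k (snd p) \<le> k (snd q)) \<and>
        (k (snd q) \<in> {k (snd p)..<k (snd p) + 1 / real (Suc n)} \<longrightarrow> k (fst p) \<le> k (fst q)))"
    for p n N
  have "\<exists>n N. good p n N"
    if p: "p \<in> D" for p
  proof -
    obtain u v where uv: "p = (u, v)" "u \<in> X" "v \<in> X" using p DX by auto
    obtain e N where e: "e > 0" and N: "open N" "u + v \<in> N"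
      and ge: "\<And>x y. x \<in> X \<Longrightarrow> y \<in> X \<Longrightarrow> x + y \<in> N \<Longrightarrow> k x \<in> {k u..<k u+e} \<Longrightarrow> k v \<le> k y"
        "\<And>x y. x \<in> X \<Longrightarrow> y \<in> X \<Longrightarrow> x + y \<in> N \<Longrightarrow> k y \<in> {k v..<k v+e} \<Longrightarrow> k u \<le> k x"
      using sum_near_imp_coordinate_ge[OF k uv(2,3)] by metis
    obtain d where d: "d > 0"
      "\<And>x y. (x, y) \<in> D \<Longrightarrow> k x \<in> {k u..<k u+d} \<Longrightarrow> k y \<in> {k v..<k v+d} \<Longrightarrow> (x, y) = (u, v)"
      using discrete_square_isolating_box[OF k D p[unfolded uv(1)]] by metis
    obtain n where n: "1 / real (Suc n) < min d e"
      using nat_approx_posE[of "min d e"] d(1) e by auto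
    have box: "D \<inter> ?box p (1 / real (Suc n)) \<subseteq> {p}"
    proof
      fix q assume q: "q \<in> D \<inter> ?box p (1 / real (Suc n))"
      then have "(fst q, snd q) = (u, v)" using n uv(1) by (intro d(2)) auto
      then show "q \<in> {p}" using uv(1) by simp
    qed
    have near: "(k (fst q) \<in> {k (fst p)..<k (fst p) + 1 / real (Suc n)} \<longrightarrow> k (snd p) \<le> k (snd q)) \<and>
        (k (snd q) \<in> {k (snd p)..<k (snd p) + 1 / real (Suc n)} \<longrightarrow> k (fst p) \<le> k (fst q))"
      if q: "q \<in> D" "?sum q \<in> N" for q
    proof -
      have "fst q \<in> X" "snd q \<in> X" using q DX by auto
      then show ?thesis
        using ge[of "fst q" "snd q"] q n uv(1) by auto
    qed
    have "good p n N" unfolding good_def using N uv(1) box near by simp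
    then show ?thesis by blast
  qed
  then obtain n N where good: "\<And>p. p \<in> D \<Longrightarrow> good p (n p) (N p)" by metis
  have N: "open (N p) \<and> ?sum p \<in> N p"
    and box: "D \<inter> ?box p (1 / real (Suc (n p))) \<subseteq> {p}" if "p \<in> D" for p
    using good[OF that] unfolding good_def by blast+
  have ge: "(k (fst q) \<in> {k (fst p)..<k (fst p) + 1 / real (Suc (n p))} \<longrightarrow> k (snd p) \<le> k (snd q)) \<and>
        (k (snd q) \<in> {k (snd p)..<k (snd p) + 1 / real (Suc (n p))} \<longrightarrow> k (fst p) \<le> k (fst q))"
    if "p \<in> D" "q \<in> D" "?sum q \<in> N p" for p q
    using good[OF that(1)] that(2,3) unfolding good_def by blast
  \<comment> \<open>Radii are taken of the form \<open>1 / (n + 1)\<close> so that there are countably many cells; a cell fixes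
    the radius and a grid square of that side length.\<close>
  define cell where
    "cell p = (n p, \<lfloor>k (fst p) * real (Suc (n p))\<rfloor>, \<lfloor>k (snd p) * real (Suc (n p))\<rfloor>)" for p
  have eq: "q = p" if p: "p \<in> D" and q: "q \<in> D" "?sum q \<in> N p" and c: "cell q = cell p" for p q
  proof -
    define e where "e = 1 / real (Suc (n p))"
    have nq: "n q = n p" using c by (simp add: cell_def)
    have close: "\<bar>k (fst q) - k (fst p)\<bar> < e" "\<bar>k (snd q) - k (snd p)\<bar> < e"
      unfolding e_def using c nq by (intro abs_diff_less_if_floor_mult_eq; simp add: cell_def)+
    have ge': "k (fst q) \<in> {k (fst p)..<k (fst p) + e} \<Longrightarrow> k (snd p) \<le> k (snd q)"
        "k (snd q) \<in> {k (snd p)..<k (snd p) + e} \<Longrightarrow> k (fst p) \<le> k (fst q)"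
      using ge[OF p q] unfolding e_def by blast+
    \<comment> \<open>If both coordinates drop from \<open>p\<close> to \<open>q\<close>, then \<open>p\<close> lies in the isolating box of \<open>q\<close>, which
      has the same size.\<close>
    consider "k (fst p) \<le> k (fst q)" "k (snd p) \<le> k (snd q)"
      | "k (fst q) \<le> k (fst p)" "k (snd q) \<le> k (snd p)"
      using ge' close by fastforce
    then show ?thesis
    proof cases
      case 1
      then have "q \<in> D \<inter> ?box p e" using q(1) close by auto
      then show ?thesis using box[OF p] unfolding e_def by blast
    next
      case 2
      then have "p \<in> D \<inter> ?box q e" using p close by auto
      then show ?thesis using box[OF q(1)] nq unfolding e_def by auto
    qed
  qed
  let ?piece = "\<lambda>i. {p \<in> D. cell p = i}"
  have piece: "|?piece i| \<le>o spread (euclidean :: 'g topology)" for i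
  proof (rule card_le_spread_if_isolated_values[where f = ?sum])
    fix p assume "p \<in> ?piece i"
    then show "\<exists>M. openin euclidean M \<and> ?sum p \<in> M \<and> (\<forall>q\<in>?piece i. ?sum q \<in> M \<longrightarrow> q = p)"
      using N[of p] eq[of p] by (intro exI[of _ "N p"]) auto
  qed
  have inf: "infinite (Field (spread (euclidean :: 'g topology)))"
    using infinite_Field_spread[OF X] finite_subset_discrete_if_sorgenfrey_embedding[OF k] by blast
  have "|UNIV :: (nat \<times> int \<times> int) set| \<le>o |UNIV :: nat set|"
    using card_of_ordLeq[of "UNIV :: (nat \<times> int \<times> int) set" "UNIV :: nat set"] inj_to_nat by blast
  moreover have "|UNIV :: nat set| \<le>o |Field (spread (euclidean :: 'g topology))|"
    using inf infinite_iff_card_of_nat by blast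
  moreover have "|Field (spread (euclidean :: 'g topology))| =o spread (euclidean :: 'g topology)"
    by (rule card_of_Field_ordIso[OF Card_order_spread])
  ultimately have "|UNIV :: (nat \<times> int \<times> int) set| \<le>o spread (euclidean :: 'g topology)"
    using ordLeq_transitive ordLeq_ordIso_trans by blast
  then have "|\<Union>i\<in>UNIV. ?piece i| \<le>o spread (euclidean :: 'g topology)"
    using inf piece by (intro card_of_UNION_ordLeq_infinite_Field Card_order_spread) auto
  moreover have "(\<Union>i\<in>UNIV. ?piece i) = D" by blast
  ultimately show ?thesis by simp
qed

theorem theorem2:
  fixes X :: "'g::topological_group_add set" and S :: "real set"
  assumes "uncountable S"
    and "subtopology (euclidean :: 'g topology) X homeomorphic_space subtopology sorgenfrey S"
  shows "spread (prod_topology (subtopology (euclidean :: 'g topology) X) (subtopology euclidean X))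
           \<le>o spread (euclidean :: 'g topology)"
proof -
  obtain k where k: "sorgenfrey_embedding X k" "k ` X = S"
    using homeomorphic_imp_sorgenfrey_embedding[OF assms(2)] .
  have "infinite X"
    using assms(1) k(2) by (auto simp: countable_finite)
  then show ?thesis
    by (intro spread_least Card_order_spread card_discrete_square_le_spread[OF k(1)])
qed

end
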